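(* Let $r \ge 2$ be an integer and let $0<c<1$ be a real number. Then there exists $n_0$ (depending only on $r$ and $c$) such that for every $n\ge n_0$ the following holds. Let $G$ be a graph on $n$ vertices with at least $c\binom{n}{r}$ copies of $K_r$. If $G$ is induced $\mathcal{K}_r^{[2]}$-free, then $$\omega(G) \ge \frac{c}{18r}\, n.$$
   Context: Graphs are finite, simple and undirected. $K_r$ is the complete graph on $r$ vertices; the number of copies of $K_r$ in $G$ is the number of $r$-element vertex subsets of $G$ that are pairwise adjacent ($r$-cliques). $\omega(G)$ denotes the clique number of $G$, i.e. the order of the largest clique in $G$. $K_r[2]$ denotes the $2$-blow-up of $K_r$: the complete $r$-partite graph in which every part has exactly two vertices. Let $u_i$ and $u_i'$ be the two vertices in the $i$-th part of $K_r[2]$ ($1\le i\le r$), let $U'=\{u_1',\dots,u_r'\}$, and let $K_{U'}$ be the subgraph of $K_r[2]$ induced by $U'$ (a complete graph on $r$ vertices). The family $\mathcal{K}_r^{[2]}$ consists of all graphs on the vertex set $\{u_1,u_1',\dots,u_r,u_r'\}$ whose edge set is of the form $(E(K_r[2])\setminus E(K_{U'}))\cup E'$ for some $E'\subseteq E(K_{U'})$. Equivalently, in a member of the family, for all distinct $i,j$ the pairs $u_iu_j$ and $u_iu_j'$ are edges; for every $i$ the pair $u_iu_i'$ is a non-edge; and the edges among the vertices $u_1',\dots,u_r'$ are arbitrary. A graph $G$ is induced $\mathcal{K}_r^{[2]}$-free if it contains no induced subgraph isomorphic to any member of $\mathcal{K}_r^{[2]}$. *)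

theory Defs
  imports Complex_Main "HOL-Library.Ramsey"
begin

text \<open>
  A graph is a pair of a vertex set and a set of edges, each edge being a two-element set
  of vertices. Cliques (pairwise adjacent sets of vertices) are those of the library,
  \<^const>\<open>clique\<close>.
\<close>

type_synonym 'a graph = "'a set \<times> 'a set set"

definition finite_simple_graph :: "'a graph \<Rightarrow> bool" where
  "finite_simple_graph G \<longleftrightarrow> finite (fst G) \<and> snd G \<subseteq> nsets (fst G) 2"

definition induced_subgraph :: "'a graph \<Rightarrow> 'a set \<Rightarrow> 'a graph" where
  "induced_subgraph G W = (W, {e \<in> snd G. e \<subseteq> W})"

definition graph_isomorphic :: "'a graph \<Rightarrow> 'b graph \<Rightarrow> bool" where
  "graph_isomorphic G H \<longleftrightarrow>
     (\<exists>f. bij_betw f (fst G) (fst H) \<and>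
          (\<forall>x\<in>fst G. \<forall>y\<in>fst G. {x, y} \<in> snd G \<longleftrightarrow> {f x, f y} \<in> snd H))"

definition induced_free :: "'a graph \<Rightarrow> 'b graph set \<Rightarrow> bool" where
  "induced_free G \<H> \<longleftrightarrow>
     \<not> (\<exists>W \<subseteq> fst G. \<exists>H \<in> \<H>. graph_isomorphic (induced_subgraph G W) H)"

definition num_cliques :: "nat \<Rightarrow> 'a graph \<Rightarrow> nat" where
  "num_cliques r G = card {K \<in> nsets (fst G) r. clique K (snd G)}"

definition clique_number :: "'a graph \<Rightarrow> nat" where
  "clique_number G = Max {card K |K. K \<subseteq> fst G \<and> clique K (snd G)}"

text \<open>
  The vertex \<open>u\<^sub>i\<close> is encoded as \<open>(i, False)\<close> and \<open>u\<^sub>i'\<close> as \<open>(i, True)\<close>.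
\<close>

definition K_blowup2 :: "nat \<Rightarrow> (nat \<times> bool) graph" where
  "K_blowup2 r =
     ({1..r} \<times> UNIV,
      {{(i, a), (j, b)} |i j a b. i \<in> {1..r} \<and> j \<in> {1..r} \<and> i \<noteq> j})"

definition U' :: "nat \<Rightarrow> (nat \<times> bool) set" where
  "U' r = {1..r} \<times> {True}"

definition K_family2 :: "nat \<Rightarrow> (nat \<times> bool) graph set" where
  "K_family2 r =
     {(fst (K_blowup2 r),
       (snd (K_blowup2 r) - snd (induced_subgraph (K_blowup2 r) (U' r))) \<union> E') |E'.
       E' \<subseteq> snd (induced_subgraph (K_blowup2 r) (U' r))}"

end

theory Submission
  imports Defs
begin

text \<open>
  Call a vertex \<open>v\<close> dominating for a clique \<open>L\<close> if it is a common neighbour of \<open>L\<close> and is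
  adjacent to every other common neighbour of \<open>L\<close>. The graphs in \<^const>\<open>K_family2\<close> leave the
  edges among the vertices \<open>u\<^sub>i'\<close> unconstrained. Hence such a graph is induced on an \<open>r\<close>-clique
  \<open>K\<close>, together with suitable \<open>u\<^sub>i'\<close>, as soon as each \<open>v \<in> K\<close> fails separately to be
  dominating for \<open>K - {v}\<close>: any witness of the failure at \<open>v = u\<^sub>i\<close> can serve as \<open>u\<^sub>i'\<close>
  (\<open>blowup_from_nonneighbours\<close>). So in a graph that is free of this family, every \<open>r\<close>-clique \<open>K\<close>
  arises from some \<open>(r-1)\<close>-clique \<open>L\<close> by adding a vertex dominating for \<open>L\<close>
  (\<open>clique_has_dominating_vertex\<close>).

  The vertices dominating for \<open>L\<close> are pairwise adjacent, so with \<open>L\<close> they form a clique, and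
  there are at most \<open>\<omega> - (r-1)\<close> of them (\<open>card_dominating_le\<close>). Counting gives
  \<open>c (n choose r) \<le> (\<omega> - (r-1)) (n choose (r-1))\<close>, that is, \<open>c (n-r+1) \<le> r (\<omega> - r+1)\<close>.
  Since \<open>c < 1 < r\<close>, this gives even \<open>\<omega> \<ge> c n / r\<close>, for every \<open>n \<ge> r\<close>.
\<close>

definition common_neighbours :: "'a graph \<Rightarrow> 'a set \<Rightarrow> 'a set" where
  "common_neighbours G L = {x \<in> fst G. \<forall>w\<in>L. {x, w} \<in> snd G}"

definition dominating :: "'a graph \<Rightarrow> 'a set \<Rightarrow> 'a set" where
  "dominating G L =
     {v \<in> common_neighbours G L. \<forall>x\<in>common_neighbours G L. x \<noteq> v \<longrightarrow> {x, v} \<in> snd G}"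

lemma no_loops:
  assumes "finite_simple_graph G"
  shows "{x} \<notin> snd G"
  using assms unfolding finite_simple_graph_def nsets_def by auto

lemma graph_isomorphicI_inverse:
  assumes "bij_betw g (fst H) (fst G)"
    and "\<And>p q. p \<in> fst H \<Longrightarrow> q \<in> fst H \<Longrightarrow> {g p, g q} \<in> snd G \<longleftrightarrow> {p, q} \<in> snd H"
  shows "graph_isomorphic G H"
  unfolding graph_isomorphic_def
proof (intro exI conjI ballI)
  let ?f = "inv_into (fst H) g"
  show f: "bij_betw ?f (fst G) (fst H)"
    using assms(1) by (rule bij_betw_inv_into)
  fix x y assume "x \<in> fst G" "y \<in> fst G"
  then have "?f x \<in> fst H" "?f y \<in> fst H" "g (?f x) = x" "g (?f y) = y"
    using f assms(1) by (auto simp: bij_betw_def f_inv_into_f intro: inv_into_into)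
  then show "{x, y} \<in> snd G \<longleftrightarrow> {?f x, ?f y} \<in> snd H"
    using assms(2)[of "?f x" "?f y"] by simp
qed

lemma K_blowup2_edge_iff:
  "{(i, a), (j, b)} \<in> snd (K_blowup2 r) \<longleftrightarrow> i \<in> {1..r} \<and> j \<in> {1..r} \<and> i \<noteq> j"
proof
  assume "{(i, a), (j, b)} \<in> snd (K_blowup2 r)"
  then obtain i' j' a' b' where "{(i, a), (j, b)} = {(i', a'), (j', b')}"
    and "i' \<in> {1..r}" "j' \<in> {1..r}" "i' \<noteq> j'"
    unfolding K_blowup2_def snd_conv mem_Collect_eq by (elim exE conjE) (rule that)
  then show "i \<in> {1..r} \<and> j \<in> {1..r} \<and> i \<noteq> j"
    by (auto simp: doubleton_eq_iff)
next
  assume "i \<in> {1..r} \<and> j \<in> {1..r} \<and> i \<noteq> j"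
  then show "{(i, a), (j, b)} \<in> snd (K_blowup2 r)"
    unfolding K_blowup2_def snd_conv by blast
qed

text \<open>
  The vertices \<open>y v\<close> are automatically distinct and outside \<open>K\<close>: \<open>v\<close> is the only vertex of
  \<open>K\<close> to which \<open>y v\<close> is not adjacent. Whatever edges they span is absorbed by the free
  choice of \<open>E'\<close> in the definition of the family.
\<close>

lemma blowup_from_nonneighbours:
  assumes G: "finite_simple_graph G"
    and K: "K \<in> nsets (fst G) r" "clique K (snd G)"
    and y: "\<And>v. v \<in> K \<Longrightarrow> y v \<in> common_neighbours G (K - {v})"
           "\<And>v. v \<in> K \<Longrightarrow> y v \<noteq> v \<and> {y v, v} \<notin> snd G"
  shows "\<not> induced_free G (K_family2 r)"
proof -
  have fin: "finite K" and card: "card K = r" and KV: "K \<subseteq> fst G"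
    using K(1) by (auto simp: nsets_def)
  obtain u where u: "bij_betw u {1..r} K"
    using ex_bij_betw_nat_finite_1[OF fin] card by auto
  define g where "g = (\<lambda>(i, b). if b then y (u i) else u i)"
  define U'edges where "U'edges = snd (induced_subgraph (K_blowup2 r) (U' r))"
  define E' where "E' = {e \<in> U'edges. g ` e \<in> snd G}"
  define H where "H = (fst (K_blowup2 r), (snd (K_blowup2 r) - U'edges) \<union> E')"
  define W where "W = g ` fst H"
  have H: "H \<in> K_family2 r"
    unfolding K_family2_def H_def E'_def U'edges_def by blast
  have fstH: "fst H = {1..r} \<times> UNIV"
    by (simp add: H_def K_blowup2_def)
  have uK: "u i \<in> K" if "i \<in> {1..r}" for i
    using u that by (rule bij_betwE[THEN bspec])
  have u_eq: "u i = u j \<longleftrightarrow> i = j" if "i \<in> {1..r}" "j \<in> {1..r}" for i j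
    using bij_betw_imp_inj_on[OF u] that by (rule inj_on_eq_iff)
  have yV: "y v \<in> fst G" if "v \<in> K" for v
    using y(1)[OF that] by (simp add: common_neighbours_def)
  have y_adj: "{y v, w} \<in> snd G \<longleftrightarrow> v \<noteq> w" if "v \<in> K" "w \<in> K" for v w
    using y[OF that(1)] that(2) by (auto simp: common_neighbours_def)
  have K_adj: "{v, w} \<in> snd G \<longleftrightarrow> v \<noteq> w" if "v \<in> K" "w \<in> K" for v w
    using K(2) that no_loops[OF G] by (auto simp: clique_def)
  have y_notin: "y v \<notin> K" if "v \<in> K" for v
    using y_adj[OF that] y(2)[OF that] no_loops[OF G] by fastforce
  have y_inj: "y v = y w \<longleftrightarrow> v = w" if "v \<in> K" "w \<in> K" for v w
    using y_adj that by metis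
  have inj: "inj_on g (fst H)"
  proof (rule inj_onI)
    fix p q assume pq: "p \<in> fst H" "q \<in> fst H" "g p = g q"
    obtain i a j b where p: "p = (i, a)" and q: "q = (j, b)" by (cases p, cases q) auto
    have ij: "i \<in> {1..r}" "j \<in> {1..r}" using pq by (auto simp: p q fstH)
    have "u i \<noteq> y (u j)" "y (u i) \<noteq> u j"
      using y_notin[OF uK[OF ij(1)]] y_notin[OF uK[OF ij(2)]] uK[OF ij(1)] uK[OF ij(2)] by metis+
    then show "p = q"
      using pq(3) y_inj[OF uK[OF ij(1)] uK[OF ij(2)]] u_eq[OF ij]
      by (cases a; cases b) (simp_all add: p q g_def)
  qed
  have WV: "W \<subseteq> fst G"
  proof -
    have "g (i, b) \<in> fst G" if "i \<in> {1..r}" for i b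
      using uK[OF that] yV[OF uK[OF that]] KV by (cases b) (auto simp: g_def)
    then show ?thesis by (auto simp: W_def fstH)
  qed
  have H_edge: "{(i, a), (j, b)} \<in> snd H \<longleftrightarrow>
      (if a \<and> b then {y (u i), y (u j)} \<in> snd G \<and> i \<noteq> j else i \<noteq> j)"
    if ij: "i \<in> {1..r}" "j \<in> {1..r}" for i j a b
  proof -
    have all: "{(i, a), (j, b)} \<in> snd (K_blowup2 r) \<longleftrightarrow> i \<noteq> j"
      using ij by (simp only: K_blowup2_edge_iff simp_thms)
    have "{(i, a), (j, b)} \<in> U'edges \<longleftrightarrow> i \<noteq> j \<and> a \<and> b"
      using all ij by (simp add: U'edges_def induced_subgraph_def U'_def)
    with all show ?thesis
      by (auto simp: H_def E'_def g_def)
  qed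
  have g_edge: "{g p, g q} \<in> snd G \<longleftrightarrow> {p, q} \<in> snd H" if pq: "p \<in> fst H" "q \<in> fst H" for p q
  proof -
    obtain i a j b where p: "p = (i, a)" and q: "q = (j, b)" by (cases p, cases q) auto
    have ij: "i \<in> {1..r}" "j \<in> {1..r}" using pq by (auto simp: p q fstH)
    have "{u i, y (u j)} \<in> snd G \<longleftrightarrow> i \<noteq> j"
      using y_adj[OF uK[OF ij(2)] uK[OF ij(1)]] u_eq[OF ij] by (auto simp: insert_commute)
    moreover have "{y (u i), u j} \<in> snd G \<longleftrightarrow> i \<noteq> j"
      using y_adj[OF uK[OF ij(1)] uK[OF ij(2)]] u_eq[OF ij] by auto
    moreover have "{u i, u j} \<in> snd G \<longleftrightarrow> i \<noteq> j"
      using K_adj[OF uK[OF ij(1)] uK[OF ij(2)]] u_eq[OF ij] by auto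
    moreover have "{y (u i), y (u j)} \<notin> snd G" if "i = j"
      using that no_loops[OF G] by simp
    ultimately show ?thesis
      unfolding p q H_edge[OF ij] by (auto simp: g_def)
  qed
  have "graph_isomorphic (induced_subgraph G W) H"
  proof (rule graph_isomorphicI_inverse)
    show "bij_betw g (fst H) (fst (induced_subgraph G W))"
      using inj by (simp add: induced_subgraph_def W_def bij_betw_def)
    show "{g p, g q} \<in> snd (induced_subgraph G W) \<longleftrightarrow> {p, q} \<in> snd H"
      if "p \<in> fst H" "q \<in> fst H" for p q
      using g_edge[OF that] that by (auto simp: induced_subgraph_def W_def)
  qed
  with H WV show ?thesis
    unfolding induced_free_def by blast
qed

lemma clique_has_dominating_vertex:
  assumes G: "finite_simple_graph G" and free: "induced_free G (K_family2 r)"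
    and K: "K \<in> nsets (fst G) r" "clique K (snd G)"
  shows "\<exists>v\<in>K. v \<in> dominating G (K - {v})"
proof (rule ccontr)
  assume none: "\<not> ?thesis"
  have nbr: "v \<in> common_neighbours G (K - {v})" if "v \<in> K" for v
    using K that by (auto simp: common_neighbours_def nsets_def clique_def)
  have "\<exists>x. x \<in> common_neighbours G (K - {v}) \<and> x \<noteq> v \<and> {x, v} \<notin> snd G" if "v \<in> K" for v
    using none nbr[OF that] that unfolding dominating_def by blast
  then obtain y where "\<And>v. v \<in> K \<Longrightarrow>
      y v \<in> common_neighbours G (K - {v}) \<and> y v \<noteq> v \<and> {y v, v} \<notin> snd G"
    by metis
  then show False
    using blowup_from_nonneighbours[OF G K, of y] free by blast
qed

lemma card_clique_le_clique_number:
  assumes "finite_simple_graph G" and "K \<subseteq> fst G" and "clique K (snd G)"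
  shows "card K \<le> clique_number G"
  unfolding clique_number_def
proof (rule Max_ge)
  have "finite (card ` Pow (fst G))"
    using assms(1) by (simp add: finite_simple_graph_def)
  then show "finite {card K |K. K \<subseteq> fst G \<and> clique K (snd G)}"
    by (rule rev_finite_subset) auto
qed (use assms in blast)

lemma card_dominating_le:
  assumes G: "finite_simple_graph G" and L: "L \<in> nsets (fst G) s" "clique L (snd G)"
  shows "card (dominating G L) \<le> clique_number G - s"
proof -
  have "finite L" "card L = s" "L \<subseteq> fst G"
    using L(1) by (auto simp: nsets_def)
  moreover have D: "dominating G L \<subseteq> fst G" "finite (dominating G L)"
    using G by (auto simp: dominating_def common_neighbours_def finite_simple_graph_def)
  moreover have "L \<inter> dominating G L = {}"
    using no_loops[OF G] by (fastforce simp: dominating_def common_neighbours_def)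
  moreover have "clique (L \<union> dominating G L) (snd G)"
    using L(2) unfolding clique_def dominating_def common_neighbours_def
    by (auto simp: insert_commute)
  ultimately show ?thesis
    using card_clique_le_clique_number[OF G, of "L \<union> dominating G L"]
    by (simp add: card_Un_disjoint)
qed

text \<open>
  By \<open>clique_has_dominating_vertex\<close>, every clique of order \<open>s + 1\<close> is counted at a clique \<open>L\<close>
  of order \<open>s\<close> from which it arises by adding a vertex dominating for \<open>L\<close>.
\<close>

lemma num_cliques_Suc_le:
  assumes G: "finite_simple_graph G" and free: "induced_free G (K_family2 (Suc s))"
  shows "num_cliques (Suc s) G \<le> (card (fst G) choose s) * (clique_number G - s)"
proof -
  define cliques where "cliques k = {K \<in> nsets (fst G) k. clique K (snd G)}" for k
  have fin: "finite (fst G)" using G by (simp add: finite_simple_graph_def)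
  have fin_cl: "finite (cliques k)" for k
    using fin by (simp add: cliques_def finite_imp_finite_nsets)
  have fin_dom: "finite (dominating G L)" for L
    using fin by (auto simp: dominating_def common_neighbours_def)
  have "cliques (Suc s) \<subseteq> (\<Union>L\<in>cliques s. (\<lambda>v. insert v L) ` dominating G L)"
  proof
    fix K assume "K \<in> cliques (Suc s)"
    then have K: "K \<in> nsets (fst G) (Suc s)" "clique K (snd G)" by (auto simp: cliques_def)
    obtain v where v: "v \<in> K" "v \<in> dominating G (K - {v})"
      using clique_has_dominating_vertex[OF G free K] by blast
    have "K - {v} \<in> cliques s"
      using K v(1) by (auto simp: cliques_def nsets_def clique_def)
    moreover have "K = insert v (K - {v})" using v(1) by blast
    ultimately show "K \<in> (\<Union>L\<in>cliques s. (\<lambda>v. insert v L) ` dominating G L)"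
      using v(2) by blast
  qed
  then have "card (cliques (Suc s)) \<le> card (\<Union>L\<in>cliques s. (\<lambda>v. insert v L) ` dominating G L)"
    by (intro card_mono) (auto simp: fin_cl fin_dom)
  also have "\<dots> \<le> (\<Sum>L\<in>cliques s. card ((\<lambda>v. insert v L) ` dominating G L))"
    by (rule card_UN_le[OF fin_cl])
  also have "\<dots> \<le> (\<Sum>L\<in>cliques s. clique_number G - s)"
  proof (rule sum_mono)
    fix L assume "L \<in> cliques s"
    then show "card ((\<lambda>v. insert v L) ` dominating G L) \<le> clique_number G - s"
      using card_dominating_le[OF G, of L s] card_image_le[OF fin_dom, of "\<lambda>v. insert v L" L]
      by (simp add: cliques_def)
  qed
  also have "\<dots> = card (cliques s) * (clique_number G - s)" by simp
  also have "card (cliques s) \<le> card (nsets (fst G) s)"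
    using fin by (intro card_mono) (auto simp: cliques_def finite_imp_finite_nsets)
  also have "card (nsets (fst G) s) = card (fst G) choose s" by simp
  finally show ?thesis by (simp add: num_cliques_def cliques_def)
qed

theorem theorem1p5:
  fixes r :: nat and c :: real
  assumes "r \<ge> 2" and "0 < c" and "c < 1"
  shows "\<exists>n0 :: nat. \<forall>n \<ge> n0. \<forall>G :: 'a graph.
           finite_simple_graph G \<longrightarrow> card (fst G) = n \<longrightarrow>
           real (num_cliques r G) \<ge> c * real (n choose r) \<longrightarrow>
           induced_free G (K_family2 r) \<longrightarrow>
           real (clique_number G) \<ge> c / (18 * real r) * real n"
proof (intro exI[of _ r] allI impI)
  fix n :: nat and G :: "'a graph"
  assume n: "r \<le> n" and G: "finite_simple_graph G" "card (fst G) = n"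
    and many: "real (num_cliques r G) \<ge> c * real (n choose r)"
    and free: "induced_free G (K_family2 r)"
  obtain s where r: "r = Suc s" using assms(1) by (cases r) auto
  define \<omega> where "\<omega> = clique_number G"
  have absorb: "r * (n choose r) = (n - s) * (n choose s)"
    using binomial_absorption[of s n] binomial_absorb_comp[of n s] by (simp add: r)
  have "num_cliques r G \<le> (n choose s) * (\<omega> - s)"
    using num_cliques_Suc_le[OF G(1)] free G(2) by (simp add: r \<omega>_def)
  then have "c * real (n choose r) \<le> real (n choose s) * real (\<omega> - s)"
    using many by (metis of_nat_le_iff of_nat_mult order_trans)
  then have "real r * (c * real (n choose r)) \<le> real r * (real (n choose s) * real (\<omega> - s))"
    by (rule mult_left_mono) simp
  moreover have "real r * real (n choose r) = real (n - s) * real (n choose s)"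
    using absorb by (metis of_nat_mult)
  ultimately have "real (n choose s) * (c * real (n - s)) \<le> real (n choose s) * (real r * real (\<omega> - s))"
    by (simp add: algebra_simps)
  moreover have "0 < real (n choose s)" using n r by simp
  ultimately have bound: "c * real (n - s) \<le> real r * real (\<omega> - s)"
    by (simp only: mult_le_cancel_left_pos)
  have "0 < c * real (n - s)" using assms(2) n r by simp
  \<comment> \<open>Thus the subtraction in \<open>\<omega> - s\<close> does not truncate.\<close>
  with bound have "0 < real r * real (\<omega> - s)" by (rule less_le_trans[rotated])
  then have "s < \<omega>" by (simp add: zero_less_mult_iff)
  with bound n r have "c * (real n - real s) \<le> real r * (real \<omega> - real s)"
    by (simp add: of_nat_diff)
  moreover have "c * real s \<le> real r * real s"
    using assms by (intro mult_right_mono) auto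
  ultimately have "c * real n \<le> real r * real \<omega>"
    by (simp add: algebra_simps)
  also have "\<dots> \<le> 18 * real r * real \<omega>" by simp
  finally show "real (clique_number G) \<ge> c / (18 * real r) * real n"
    using assms(1) by (simp add: \<omega>_def field_simps)
qed

end
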